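(* For every $n\ge1$, the map $h$ is a bijection from $\bigcup_{\pi\in S_n}\mathrm{Mad}(\mathrm{LMin}(\pi))$ to $\mathrm{Asc}_n\times S_n$.
   Context: $[a,b]=\{i\in\mathbb Z:a\le i\le b\}$; $S_n$ is the set of permutations of $[1,n]$, written in one-line notation as words. For a sequence $(a_1,\dots,a_i)$ let $\mathrm{asc}(a_1,\dots,a_i)=|\{j\in[1,i-1]:a_j<a_{j+1}\}|$. A sequence $(a_1,\dots,a_m)$ of non-negative integers is an ascent sequence if $a_1=0$ and $a_{i+1}\in[0,1+\mathrm{asc}(a_1,\dots,a_i)]$ for $0<i<m$; $\mathrm{Asc}_m$ is the set of ascent sequences of length $m$. Writing a sequence $\alpha$ uniquely as $m_1$ copies of $c_1$, then $m_2$ copies of $c_2$, \dots, then $m_r$ copies of $c_r$ with $m_j\ge1$ and $c_j\neq c_{j+1}$, its run-length encoding is $\mathrm{RLE}(\alpha)=(c_1,m_1)\cdots(c_r,m_r)$ and its run-length record is $\mathrm{RLR}(\alpha)=(m_1,\dots,m_r)$. For a finite set $Y$ and positive integers $m_1,\dots,m_r$ summing to $|Y|$, $\binom{Y}{m_1,\dots,m_r}$ denotes the set of ordered set partitions $(Y_1,\dots,Y_r)$ of $Y$ with $|Y_j|=m_j$. Define $\mathrm{Mad}(Y)=\bigcup_{\alpha\in\mathrm{Asc}_{|Y|}}\{\alpha\}\times\binom{Y}{\mathrm{RLR}(\alpha)}$. For $\pi=\pi_1\cdots\pi_n\in S_n$, $\pi_j$ is a left-to-right minimum if $\pi_j<\pi_i$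 for all $i<j$; $\mathrm{LMin}(\pi)$ is the set of words (segments) obtained by cutting $\pi$ immediately before each left-to-right minimum, e.g. $\mathrm{LMin}(5731462)=\{57,3,1462\}$. The domain of $h$ is the set of pairs $(\alpha,\chi)$ where, for some $\pi\in S_n$ with $k$ left-to-right minima, $\alpha=(a_1,\dots,a_k)\in\mathrm{Asc}_k$ and $\chi=(X_1,\dots,X_r)\in\binom{\mathrm{LMin}(\pi)}{\mathrm{RLR}(\alpha)}$ (note $\pi$ is determined by $\mathrm{LMin}(\pi)$). Definition of $h(\alpha,\chi)=(\beta,\tau)$: for each $j\in[1,r]$ let $\hat X_j$ be the word obtained by ordering the segments in $X_j$ in decreasing order of their first letters and concatenating them. Let $\tau=\hat X_1\hat X_2\cdots\hat X_r\in S_n$. Let $i_1=1$ and $i_{j+1}=i_j+|X_j|$, so $a_{i_j}$ is the common value of the $j$th run of $\alpha$. Let $\beta$ be the sequence with $\mathrm{RLE}(\beta)=(a_{i_1},\ell_1)(a_{i_2},\ell_2)\cdots(a_{i_r},\ell_r)$, where $\ell_j$ is the length of the word $\hat X_j$; i.e. $\beta$ consists of $\ell_1$ copies of $a_{i_1}$, then $\ell_2$ copies of $a_{i_2}$, etc. *)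

theory Defs
  imports "HOL-Combinatorics.Multiset_Permutations"
begin

text \<open>
  Sequences and words are lists. List positions count from 0, so the entry \<open>a\<^sub>i\<close> of the
  mathematical notation is \<open>a ! (i - 1)\<close>. The set \<open>S\<^sub>n\<close> of permutations in one-line notation is
  \<^term>\<open>permutations_of_set {1..n::nat}\<close>.
\<close>

definition asc :: "nat list \<Rightarrow> nat" where
  "asc a = card {j. Suc j < length a \<and> a ! j < a ! Suc j}"

definition Asc :: "nat \<Rightarrow> nat list set" where
  "Asc m = {a. length a = m \<and> (0 < m \<longrightarrow> a ! 0 = 0) \<and>
               (\<forall>i. 0 < i \<and> i < m \<longrightarrow> a ! i \<le> 1 + asc (take i a))}"

fun RLE :: "'a list \<Rightarrow> ('a \<times> nat) list" where
  "RLE [] = []"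
| "RLE (x # xs) =
     (case RLE xs of
        [] \<Rightarrow> [(x, 1)]
      | (c, m) # ps \<Rightarrow> if x = c then (c, Suc m) # ps else (x, 1) # (c, m) # ps)"

definition run_decode :: "('a \<times> nat) list \<Rightarrow> 'a list" where
  "run_decode ps = concat (map (\<lambda>(c, m). replicate m c) ps)"

definition RLR :: "'a list \<Rightarrow> nat list" where
  "RLR xs = map snd (RLE xs)"

lemma run_decode_RLE: "run_decode (RLE xs) = xs"
  by (induction xs) (auto simp: run_decode_def split: list.splits prod.splits if_splits)

lemma RLE_pos: "p \<in> set (RLE xs) \<Longrightarrow> 1 \<le> snd p"
  by (induction xs arbitrary: p) (fastforce split: list.splits prod.splits if_splits)+

lemma RLE_distinct_adj: "distinct_adj (map fst (RLE xs))"
  by (induction xs) (auto split: list.splits prod.splits if_splits)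

lemma RLE_replicate_append:
  assumes "RLE ys = [] \<or> fst (hd (RLE ys)) \<noteq> c"
  shows "RLE (replicate (Suc m) c @ ys) = (c, Suc m) # RLE ys"
  using assms by (induction m) (auto split: list.splits prod.splits)

lemma RLE_run_decode:
  assumes "\<forall>p\<in>set ps. 1 \<le> snd p" and "distinct_adj (map fst ps)"
  shows "RLE (run_decode ps) = ps"
  using assms
proof (induction ps)
  case Nil
  then show ?case by (simp add: run_decode_def)
next
  case (Cons p ps)
  obtain c m where p: "p = (c, Suc m)"
    using Cons.prems(1) by (cases p; cases "snd p") auto
  have IH: "RLE (run_decode ps) = ps"
    using Cons by (cases ps) auto
  have "RLE (run_decode ps) = [] \<or> fst (hd (RLE (run_decode ps))) \<noteq> c"
    unfolding IH using Cons.prems(2) p by (cases ps) auto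
  then have "RLE (replicate (Suc m) c @ run_decode ps) = (c, Suc m) # ps"
    using RLE_replicate_append IH by metis
  moreover have "run_decode (p # ps) = replicate (Suc m) c @ run_decode ps"
    by (simp add: p run_decode_def)
  ultimately show ?case
    by (simp only: p)
qed

lemma RLE_eq_iff:
  "RLE xs = ps \<longleftrightarrow>
     xs = run_decode ps \<and> (\<forall>p\<in>set ps. 1 \<le> snd p) \<and> distinct_adj (map fst ps)"
  using run_decode_RLE RLE_pos RLE_distinct_adj RLE_run_decode by metis

definition ordered_set_partitions :: "'a set \<Rightarrow> nat list \<Rightarrow> 'a set list set" where
  "ordered_set_partitions Y ms =
     {Ys. length Ys = length ms \<and> \<Union> (set Ys) = Y \<and>
          (\<forall>i<length Ys. \<forall>j<length Ys. i \<noteq> j \<longrightarrow> Ys ! i \<inter> Ys ! j = {}) \<and>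
          (\<forall>j<length Ys. card (Ys ! j) = ms ! j)}"

definition Mad :: "'a set \<Rightarrow> (nat list \<times> 'a set list) set" where
  "Mad Y = (\<Union>\<alpha>\<in>Asc (card Y). {\<alpha>} \<times> ordered_set_partitions Y (RLR \<alpha>))"

definition is_lr_min :: "nat list \<Rightarrow> nat \<Rightarrow> bool" where
  "is_lr_min w j \<longleftrightarrow> j < length w \<and> (\<forall>i<j. w ! j < w ! i)"

text \<open>
  The segment occupying positions \<open>j, \<dots>, k - 1\<close> starts at a left-to-right minimum, contains no
  further one, and ends just before the next left-to-right minimum or at the end of the word.
\<close>
definition LMin :: "nat list \<Rightarrow> nat list set" where
  "LMin w = {take (k - j) (drop j w) | j k.
               j < k \<and> is_lr_min w j \<and> (k = length w \<or> is_lr_min w k) \<and>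
               (\<forall>i. j < i \<and> i < k \<longrightarrow> \<not> is_lr_min w i)}"

text \<open>
  First letters of distinct segments of a permutation are distinct, so ordering the segments by
  their first letters is unambiguous.
\<close>
definition seg_word :: "nat list set \<Rightarrow> nat list" where
  "seg_word X = concat (rev (sorted_key_list_of_set hd X))"

definition h :: "nat list \<times> nat list set list \<Rightarrow> nat list \<times> nat list" where
  "h = (\<lambda>(\<alpha>, \<chi>).
     (run_decode (map (\<lambda>j. (\<alpha> ! (\<Sum>i<j. card (\<chi> ! i)), length (seg_word (\<chi> ! j))))
                   [0..<length \<chi>]),
      concat (map seg_word \<chi>)))"

end

theory Submission
  imports Defs
begin

text \<open>
  A finite set of segments (nonempty words starting with their minimum, with distinct first
  letters) carries the same information as the word \<^const>\<open>seg_word\<close> makes of it: cutting that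
  word before its left-to-right minima recovers the set, and conversely. Whether a sequence is an
  ascent sequence depends only on the values of its runs, not on the (positive) run lengths.
  Hence the inverse of \<^const>\<open>h\<close> cuts \<open>\<tau>\<close> into pieces of lengths \<open>RLR \<beta>\<close>, cuts each
  piece into its segments, and takes the numbers of segments as the new run lengths.
\<close>

section \<open>Cutting words at left-to-right minima\<close>

text \<open>The inequality is weak because left-to-right minima are strict: a later letter equal to
  the first one starts no new segment. So the cutting works for arbitrary words, not only
  permutations.\<close>

definition is_segment :: "nat list \<Rightarrow> bool" where
  "is_segment b \<longleftrightarrow> b \<noteq> [] \<and> (\<forall>y\<in>set b. hd b \<le> y)"

text \<open>These turn out to be exactly the sets \<open>LMin w\<close>, with \<open>w\<close> an
  arbitrary word.\<close>

definition segment_set :: "nat list set \<Rightarrow> bool" where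
  "segment_set X \<longleftrightarrow> finite X \<and> (\<forall>b\<in>X. is_segment b) \<and> inj_on hd X"

definition decreasing_segments :: "nat list list \<Rightarrow> bool" where
  "decreasing_segments bs \<longleftrightarrow> (\<forall>b\<in>set bs. is_segment b) \<and> sorted_wrt (>) (map hd bs)"

text \<open>No letter of \<open>u\<close> is below the first one, so only position 0 counts within
  \<open>u\<close>. A left-to-right minimum of \<open>v\<close> is at most \<open>hd v\<close>,
  hence below every letter of \<open>u\<close>, so prepending \<open>u\<close> does not affect
  it.\<close>

lemma is_lr_min_append:
  assumes u: "is_segment u" and v: "v = [] \<or> hd v < hd u"
  shows "is_lr_min (u @ v) j \<longleftrightarrow> j = 0 \<or> (length u \<le> j \<and> is_lr_min v (j - length u))"
proof -
  have hdu: "u ! 0 = hd u" "u \<noteq> []" using u by (auto simp: is_segment_def hd_conv_nth)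
  have ge: "hd u \<le> u ! i" if "i < length u" for i
    using u that by (auto simp: is_segment_def)
  consider "j = 0" | "0 < j" "j < length u" | "length u \<le> j" by linarith
  then show ?thesis
  proof cases
    case 1
    then show ?thesis using hdu by (simp add: is_lr_min_def)
  next
    case 2
    then have "\<not> (u @ v) ! j < (u @ v) ! 0"
      using ge[of j] hdu by (simp add: nth_append)
    then show ?thesis using 2 by (auto simp: is_lr_min_def)
  next
    case 3
    define k where "k = j - length u"
    have j: "j = length u + k" using 3 by (simp add: k_def)
    have "is_lr_min (u @ v) j" if m: "is_lr_min v k"
      unfolding is_lr_min_def
    proof (intro conjI allI impI)
      have k: "k < length v" using m by (simp add: is_lr_min_def)
      then show "j < length (u @ v)" by (simp add: j)
      fix i assume i: "i < j"
      have "v ! k \<le> v ! 0"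
        using m by (cases "k = 0") (auto simp: is_lr_min_def intro: less_imp_le)
      then have "v ! k < hd u" using v k hd_conv_nth[of v] by force
      then show "(u @ v) ! j < (u @ v) ! i"
        using m i ge[of i] by (cases "i < length u") (auto simp: j nth_append is_lr_min_def)
    qed
    moreover have "is_lr_min v k" if m: "is_lr_min (u @ v) j"
      unfolding is_lr_min_def
    proof (intro conjI allI impI)
      show "k < length v" using m by (simp add: is_lr_min_def j)
      fix i assume "i < k"
      then have "(u @ v) ! j < (u @ v) ! (length u + i)"
        using m j unfolding is_lr_min_def by (metis add_less_cancel_left)
      then show "v ! k < v ! i" by (simp add: j)
    qed
    ultimately show ?thesis using 3 hdu by (auto simp: k_def)
  qed
qed

lemma LMin_Nil: "LMin [] = {}"
  by (auto simp: LMin_def is_lr_min_def)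

lemma is_lr_min_0: "v \<noteq> [] \<Longrightarrow> is_lr_min v 0"
  by (simp add: is_lr_min_def)

lemma LMin_append:
  assumes u: "is_segment u" and v: "v = [] \<or> hd v < hd u"
  shows "LMin (u @ v) = insert u (LMin v)"
proof (intro equalityI subsetI)
  note lr = is_lr_min_append[OF u v]
  have ne: "u \<noteq> []" using u by (simp add: is_segment_def)
  \<comment> \<open>The segment \<open>u\<close> ends where \<open>v\<close> begins: either at the
    end of the word or at the first letter of \<open>v\<close>, which is a new minimum.\<close>
  have end_u: "length u = length (u @ v) \<or> is_lr_min (u @ v) (length u)"
    by (cases "v = []") (auto simp: lr is_lr_min_0)
  {
    fix s assume "s \<in> LMin (u @ v)"
    then obtain j k where s: "s = take (k - j) (drop j (u @ v))" and jk: "j < k"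
      and j: "is_lr_min (u @ v) j" and k: "k = length (u @ v) \<or> is_lr_min (u @ v) k"
      and between: "\<And>i. j < i \<Longrightarrow> i < k \<Longrightarrow> \<not> is_lr_min (u @ v) i"
      unfolding LMin_def by blast
    \<comment> \<open>An endpoint is positive, and \<open>u\<close> has no left-to-right minimum at
      a positive position.\<close>
    have ku: "length u \<le> k" using k jk by (auto simp: lr)
    show "s \<in> insert u (LMin v)"
    proof (cases "j = 0")
      case True
      have "\<not> length u < k"
      proof
        assume lt: "length u < k"
        moreover have "k \<le> length (u @ v)" using k by (auto simp: is_lr_min_def)
        ultimately have "is_lr_min (u @ v) (length u)" using end_u by auto
        then show False using between[of "length u"] lt True ne by auto
      qed
      then have "k = length u" using ku by simp
      then show ?thesis using True s by simp
    next
      case False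
      then have ju: "length u \<le> j" and jv: "is_lr_min v (j - length u)"
        using j by (auto simp: lr)
      have "s = take ((k - length u) - (j - length u)) (drop (j - length u) v)"
        using s ju by simp
      moreover have "k - length u = length v \<or> is_lr_min v (k - length u)"
        using k jk by (auto simp: lr)
      moreover have "\<not> is_lr_min v i" if "j - length u < i" "i < k - length u" for i
        using between[of "length u + i"] that ju by (auto simp: lr)
      moreover have "j - length u < k - length u" using jk ju by simp
      ultimately show ?thesis using jv unfolding LMin_def by blast
    qed
  }
  fix s assume "s \<in> insert u (LMin v)"
  then consider "s = u" | "s \<in> LMin v" by blast
  then show "s \<in> LMin (u @ v)"
  proof cases
    case 1
    have "s = take (length u - 0) (drop 0 (u @ v))" using 1 by simp
    moreover have "is_lr_min (u @ v) 0" by (simp add: lr)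
    moreover have "\<not> is_lr_min (u @ v) i" if "0 < i" "i < length u" for i
      using that by (simp add: lr)
    moreover have "0 < length u" using ne by simp
    ultimately show ?thesis using end_u unfolding LMin_def by blast
  next
    case 2
    then obtain j k where s: "s = take (k - j) (drop j v)" and jk: "j < k"
      and j: "is_lr_min v j" and k: "k = length v \<or> is_lr_min v k"
      and between: "\<And>i. j < i \<Longrightarrow> i < k \<Longrightarrow> \<not> is_lr_min v i"
      unfolding LMin_def by blast
    have "s = take ((length u + k) - (length u + j)) (drop (length u + j) (u @ v))"
      using s by simp
    moreover have "is_lr_min (u @ v) (length u + j)" using j by (simp add: lr)
    moreover have "length u + k = length (u @ v) \<or> is_lr_min (u @ v) (length u + k)"
      using k by (auto simp: lr)
    moreover have "\<not> is_lr_min (u @ v) i" if "length u + j < i" "i < length u + k" for i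
      using between[of "i - length u"] that by (auto simp: lr)
    moreover have "length u + j < length u + k" using jk by simp
    ultimately show ?thesis unfolding LMin_def by blast
  qed
qed

section \<open>Factorization of a word into segments with decreasing first letters\<close>

lemma decreasing_segments_Cons:
  "decreasing_segments (b # bs) \<longleftrightarrow>
     is_segment b \<and> decreasing_segments bs \<and> (\<forall>c\<in>set bs. hd c < hd b)"
  by (auto simp: decreasing_segments_def)

lemma hd_concat_decreasing_segments:
  assumes "decreasing_segments (b # bs)"
  shows "concat bs = [] \<or> hd (concat bs) < hd b"
  using assms by (cases bs) (auto simp: decreasing_segments_Cons is_segment_def)

lemma LMin_concat:
  assumes "decreasing_segments bs"
  shows "LMin (concat bs) = set bs"
  using assms
proof (induction bs)
  case Nil
  then show ?case by (simp add: LMin_Nil)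
next
  case (Cons b bs)
  then show ?case
    using LMin_append[OF _ hd_concat_decreasing_segments[OF Cons.prems]]
    by (simp add: decreasing_segments_Cons)
qed

text \<open>Greedy cutting: the first segment extends up to the first letter smaller than its own
  first letter, and the rest is shorter.\<close>

lemma ex_decreasing_segments: "\<exists>bs. decreasing_segments bs \<and> concat bs = w"
proof (induction w rule: length_induct)
  case (1 w)
  show ?case
  proof (cases w)
    case Nil
    then show ?thesis by (intro exI[of _ "[]"]) (simp add: decreasing_segments_def)
  next
    case (Cons x xs)
    define u where "u = x # takeWhile (\<lambda>y. x \<le> y) xs"
    define v where "v = dropWhile (\<lambda>y. x \<le> y) xs"
    have w: "w = u @ v" by (simp add: Cons u_def v_def)
    have "length v < length w" by (simp add: w u_def)
    then obtain bs where bs: "decreasing_segments bs" "concat bs = v"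
      using "1.IH" by blast
    have u: "is_segment u" by (auto simp: is_segment_def u_def dest: set_takeWhileD)
    have "hd c < hd u" if "c \<in> set bs" for c
    proof -
      obtain b cs where bs_eq: "bs = b # cs" using \<open>c \<in> set bs\<close> by (cases bs) auto
      then have "b \<noteq> []" using bs by (simp add: decreasing_segments_Cons is_segment_def)
      then have v: "v \<noteq> []" "hd v = hd b" using bs bs_eq by auto
      have "hd v < x" using hd_dropWhile[of "\<lambda>y. x \<le> y" xs] v by (simp add: v_def)
      moreover have "hd c \<le> hd b" using that bs bs_eq by (auto simp: decreasing_segments_Cons)
      ultimately show ?thesis using v by (simp add: u_def)
    qed
    then have "decreasing_segments (u # bs)" using u bs by (simp add: decreasing_segments_Cons)
    then show ?thesis using bs w by (intro exI[of _ "u # bs"]) simp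
  qed
qed

lemma segment_set_decreasing_segments:
  assumes "decreasing_segments bs"
  shows "segment_set (set bs)" "distinct bs"
proof -
  have "distinct (map hd bs)"
    using assms by (auto simp: decreasing_segments_def sorted_wrt_iff_nth_less distinct_conv_nth
        linorder_neq_iff)
  then show "segment_set (set bs)" "distinct bs"
    using assms by (auto simp: segment_set_def decreasing_segments_def distinct_map)
qed

text \<open>
  Stated in the class context because interpreting \<^locale>\<open>folding_insort_key\<close> at a type instance
  yields the foundational constant instead of the class operation.
\<close>
lemma (in linorder) sorted_key_list_of_set_eq_iff:
  assumes "inj_on f A" "finite A"
  shows "sorted_key_list_of_set f A = l \<longleftrightarrow>
         sorted_wrt (<) (map f l) \<and> set l = A \<and> length l = card A"
proof -
  interpret key: folding_insort_key "(\<le>)" "(<)" A f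
    using assms(1) by unfold_locales
  show ?thesis using key.sorted_key_list_of_set_unique[OF subset_refl assms(2)] by simp
qed

text \<open>Strict monotonicity of first letters leaves only one order for the segments, so any
  decreasing arrangement is the one chosen by \<open>seg_word\<close>.\<close>

lemma seg_word_eq_concat:
  assumes "segment_set X"
  shows "decreasing_segments bs \<and> set bs = X \<Longrightarrow> seg_word X = concat bs"
    and "\<exists>bs. decreasing_segments bs \<and> set bs = X"
proof -
  have "inj_on hd X" "finite X" using assms by (simp_all add: segment_set_def)
  note unique = sorted_key_list_of_set_eq_iff[OF this]
  define bs0 where "bs0 = rev (sorted_key_list_of_set hd X)"
  have bs0: "sorted_wrt (<) (map hd (rev bs0))" "set (rev bs0) = X"
    using unique[of "rev bs0"] by (auto simp: bs0_def)
  then show "\<exists>bs. decreasing_segments bs \<and> set bs = X"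
    using assms by (intro exI[of _ bs0])
      (auto simp: decreasing_segments_def segment_set_def rev_map[symmetric] sorted_wrt_rev)
  assume bs: "decreasing_segments bs \<and> set bs = X"
  then have "sorted_wrt (<) (map hd (rev bs))" "length (rev bs) = card X"
    using segment_set_decreasing_segments(2)[of bs]
    by (auto simp: decreasing_segments_def rev_map[symmetric] sorted_wrt_rev distinct_card)
  then have "sorted_key_list_of_set hd X = rev bs" using unique[of "rev bs"] bs by auto
  then show "seg_word X = concat bs" by (simp add: seg_word_def)
qed

text \<open>Together with \<open>segment_set_LMin\<close> and \<open>seg_word_LMin\<close>, this
  makes \<open>LMin\<close> and \<open>seg_word\<close> mutually inverse between words and segment
  sets.\<close>

lemma LMin_seg_word: "segment_set X \<Longrightarrow> LMin (seg_word X) = X"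
  using seg_word_eq_concat LMin_concat by metis

lemma segment_set_LMin: "segment_set (LMin w)"
  using ex_decreasing_segments[of w] LMin_concat segment_set_decreasing_segments(1) by metis

lemma seg_word_LMin: "seg_word (LMin w) = w"
  using ex_decreasing_segments[of w] LMin_concat seg_word_eq_concat(1)[OF segment_set_LMin]
  by metis

lemma set_seg_word: "segment_set X \<Longrightarrow> set (seg_word X) = \<Union> (set ` X)"
  using seg_word_eq_concat by (metis set_concat)

lemma length_seg_word:
  assumes "segment_set X"
  shows "length (seg_word X) = sum length X"
proof -
  obtain bs where bs: "decreasing_segments bs" "set bs = X"
    using seg_word_eq_concat(2)[OF assms] by blast
  then show ?thesis
    using seg_word_eq_concat(1)[OF assms] segment_set_decreasing_segments(2)[OF bs(1)]
    by (auto simp: length_concat sum_list_distinct_conv_sum_set)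
qed

lemma LMin_ne: "w \<noteq> [] \<Longrightarrow> LMin w \<noteq> {}"
  using length_seg_word[OF segment_set_LMin, of w] by (auto simp: seg_word_LMin)

lemma segment_set_subset: "segment_set Y \<Longrightarrow> X \<subseteq> Y \<Longrightarrow> segment_set X"
  by (auto simp: segment_set_def intro: finite_subset inj_on_subset)

section \<open>Run lengths of ascent sequences\<close>

text \<open>
  \<open>bounded_from p k xs\<close>: the list \<open>xs\<close> extends an ascent sequence with last entry \<open>p\<close> and \<open>k\<close>
  ascents to an ascent sequence.
\<close>
fun bounded_from :: "nat \<Rightarrow> nat \<Rightarrow> nat list \<Rightarrow> bool" where
  "bounded_from p k [] = True"
| "bounded_from p k (x # xs) =
     (x \<le> 1 + k \<and> bounded_from x (k + (if p < x then 1 else 0)) xs)"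

lemma asc_single: "asc [x] = 0"
  by (simp add: asc_def)

lemma asc_Cons_Cons: "asc (p # x # xs) = (if p < x then 1 else 0) + asc (x # xs)"
proof -
  let ?A = "{j. Suc j < length (x # xs) \<and> (x # xs) ! j < (x # xs) ! Suc j}"
  have fin: "finite ?A" by (rule finite_subset[of _ "{..length (x # xs)}"]) auto
  \<comment> \<open>Old ascents move one place to the right; position 0 is new and is an ascent iff
    \<open>p < x\<close>.\<close>
  have "{j. Suc j < length (p # x # xs) \<and> (p # x # xs) ! j < (p # x # xs) ! Suc j}
      = (if p < x then {0} else {}) \<union> Suc ` ?A" (is "?L = ?R")
  proof (rule set_eqI)
    fix j show "j \<in> ?L \<longleftrightarrow> j \<in> ?R" by (cases j) auto
  qed
  then show ?thesis
    using fin by (auto simp: asc_def card_image card_insert_if)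
qed

lemma bounded_from_iff:
  "bounded_from p k xs \<longleftrightarrow> (\<forall>i<length xs. xs ! i \<le> 1 + k + asc (p # take i xs))"
proof (induction xs arbitrary: p k)
  case (Cons x xs)
  show ?case
    by (auto simp: Cons.IH All_less_Suc2 asc_single asc_Cons_Cons add.assoc)
qed simp

lemma Asc_iff_bounded_from:
  "\<alpha> \<in> Asc (length \<alpha>) \<longleftrightarrow> \<alpha> = [] \<or> (\<exists>xs. \<alpha> = 0 # xs \<and> bounded_from 0 0 xs)"
proof (cases \<alpha>)
  case (Cons a xs)
  have "(\<forall>i. 0 < i \<and> i < length \<alpha> \<longrightarrow> \<alpha> ! i \<le> 1 + asc (take i \<alpha>)) \<longleftrightarrow>
        (\<forall>i<length xs. xs ! i \<le> 1 + asc (a # take i xs))"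
    unfolding Cons by (auto simp: gr0_conv_Suc)
  then show ?thesis by (auto simp: Asc_def Cons bounded_from_iff)
qed (simp add: Asc_def)

text \<open>Repeating the last entry creates no ascent, so the state \<open>p\<close>,
  \<open>k\<close> is unchanged; the hypothesis makes the repeated entry itself admissible.\<close>

lemma bounded_from_replicate:
  "p \<le> 1 + k \<Longrightarrow> bounded_from p k (replicate m p @ xs) \<longleftrightarrow> bounded_from p k xs"
  by (induction m) auto

lemma run_decode_Nil: "run_decode [] = []"
  by (simp add: run_decode_def)

lemma run_decode_Cons: "run_decode ((c, m) # ps) = replicate m c @ run_decode ps"
  by (simp add: run_decode_def)

lemma bounded_from_run_decode:
  assumes "\<forall>p\<in>set ps. 1 \<le> snd p"
  shows "bounded_from p k (run_decode ps) \<longleftrightarrow> bounded_from p k (map fst ps)"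
  using assms
proof (induction ps arbitrary: p k)
  case (Cons q ps)
  \<comment> \<open>The first copy of \<open>c\<close> updates the state; the other \<open>m\<close>
    copies are absorbed by \<open>bounded_from_replicate\<close>.\<close>
  obtain c m where q: "q = (c, Suc m)"
    using Cons.prems by (cases q; cases "snd q") auto
  show ?case using Cons by (auto simp: q run_decode_Cons bounded_from_replicate)
qed (simp add: run_decode_Nil)

lemma run_decode_in_Asc_iff:
  assumes "\<forall>p\<in>set ps. 1 \<le> snd p"
  shows "run_decode ps \<in> Asc (length (run_decode ps)) \<longleftrightarrow>
         map fst ps \<in> Asc (length ps)"
proof (cases ps)
  case (Cons q qs)
  obtain c m where q: "q = (c, Suc m)"
    using assms Cons by (cases q; cases "snd q") auto
  have "\<forall>p\<in>set qs. 1 \<le> snd p" using assms Cons by simp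
  then show ?thesis
    using Asc_iff_bounded_from[of "run_decode ps"] Asc_iff_bounded_from[of "map fst ps"]
    by (auto simp: Cons q run_decode_Cons bounded_from_replicate bounded_from_run_decode)
qed (simp add: run_decode_Nil Asc_def)

lemma length_run_decode: "length (run_decode ps) = sum_list (map snd ps)"
  by (induction ps) (auto simp: run_decode_Nil run_decode_Cons)

text \<open>Justifies the index used by \<open>h\<close>: with positions counted from 0, a run
  starts at the sum of the preceding run lengths, and being nonempty it shows its value
  there.\<close>

lemma run_decode_nth_start:
  assumes "\<forall>p\<in>set ps. 1 \<le> snd p" "j < length ps"
  shows "run_decode ps ! (\<Sum>i<j. snd (ps ! i)) = fst (ps ! j)"
  using assms
proof (induction ps arbitrary: j)
  case (Cons q ps)
  obtain c m where q: "q = (c, Suc m)"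
    using Cons.prems(1) by (cases q; cases "snd q") auto
  show ?case
  proof (cases j)
    case 0
    then show ?thesis by (simp add: q run_decode_Cons)
  next
    case (Suc j')
    have "(\<Sum>i<j. snd ((q # ps) ! i)) = Suc m + (\<Sum>i<j'. snd (ps ! i))"
      unfolding Suc by (subst sum.lessThan_Suc_shift) (simp add: q)
    then show ?thesis using Cons.IH[of j'] Cons.prems Suc
      by (simp add: q run_decode_Cons nth_append)
  qed
qed simp

text \<open>Removes the index arithmetic from \<open>h\<close>: run values stay, and each
  multiplicity changes from a number of segments to a number of letters.\<close>

lemma h_run_decode:
  assumes "length cs = length \<chi>" "\<forall>X\<in>set \<chi>. 1 \<le> card X"
  shows "h (run_decode (zip cs (map card \<chi>)), \<chi>) =
         (run_decode (zip cs (map (length \<circ> seg_word) \<chi>)), concat (map seg_word \<chi>))"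
proof -
  let ?ps = "zip cs (map card \<chi>)"
  have pos: "\<forall>p\<in>set ?ps. 1 \<le> snd p" using assms by (auto dest!: set_zip_rightD)
  have "run_decode ?ps ! (\<Sum>i<j. card (\<chi> ! i)) = cs ! j" if "j < length \<chi>" for j
  proof -
    have "(\<Sum>i<j. card (\<chi> ! i)) = (\<Sum>i<j. snd (?ps ! i))"
      using that assms by (intro sum.cong) auto
    then show ?thesis using run_decode_nth_start[OF pos, of j] that assms by simp
  qed
  then have "map (\<lambda>j. (run_decode ?ps ! (\<Sum>i<j. card (\<chi> ! i)), length (seg_word (\<chi> ! j))))
                   [0..<length \<chi>] = zip cs (map (length \<circ> seg_word) \<chi>)"
    using assms by (intro nth_equalityI) auto
  then show ?thesis by (simp add: h_def)
qed

section \<open>The inverse map\<close>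

fun chunks :: "nat list \<Rightarrow> 'a list \<Rightarrow> 'a list list" where
  "chunks [] w = []"
| "chunks (l # ls) w = take l w # chunks ls (drop l w)"

lemma chunks_concat: "chunks (map length ws) (concat ws) = ws"
  by (induction ws) auto

lemma chunks_inverse:
  "sum_list ls = length w \<Longrightarrow> concat (chunks ls w) = w \<and> map length (chunks ls w) = ls"
  by (induction ls arbitrary: w) auto

definition h_inv :: "nat list \<times> nat list \<Rightarrow> nat list \<times> nat list set list" where
  "h_inv = (\<lambda>(\<beta>, \<tau>).
     let \<chi> = map LMin (chunks (RLR \<beta>) \<tau>)
     in (run_decode (zip (map fst (RLE \<beta>)) (map card \<chi>)), \<chi>))"

lemma run_decode_zip_RLE: "run_decode (zip (map fst (RLE xs)) (RLR xs)) = xs"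
  unfolding RLR_def zip_map_fst_snd by (rule run_decode_RLE)

lemma RLE_run_decode_zip:
  assumes "length cs = length ms" "\<forall>m\<in>set ms. 1 \<le> m" "distinct_adj cs"
  shows "RLE (run_decode (zip cs ms)) = zip cs ms"
  using assms by (intro RLE_run_decode) (auto dest: set_zip_rightD)

text \<open>Collapse \<alpha> to its run values, then expand them with the new multiplicities;
  \<open>run_decode_in_Asc_iff\<close> covers both directions.\<close>

lemma change_run_lengths_in_Asc:
  assumes "\<alpha> \<in> Asc (length \<alpha>)" "length ms = length (RLE \<alpha>)" "\<forall>m\<in>set ms. 1 \<le> m"
  shows "run_decode (zip (map fst (RLE \<alpha>)) ms) \<in> Asc (sum_list ms)"
proof -
  let ?ps = "zip (map fst (RLE \<alpha>)) ms"
  have "map fst (RLE \<alpha>) \<in> Asc (length (RLE \<alpha>))"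
    using run_decode_in_Asc_iff[of "RLE \<alpha>"] RLE_pos[of _ \<alpha>] assms(1)
    by (simp add: run_decode_RLE)
  moreover have "\<forall>p\<in>set ?ps. 1 \<le> snd p" using assms(3) by (auto dest: set_zip_rightD)
  ultimately have "run_decode ?ps \<in> Asc (length (run_decode ?ps))"
    using run_decode_in_Asc_iff[of ?ps] assms(2) by simp
  then show ?thesis using assms(2) by (simp add: length_run_decode)
qed

lemma RLR_pos: "\<forall>m\<in>set (RLR xs). 1 \<le> m"
  using RLE_pos[of _ xs] by (auto simp: RLR_def)

lemma sum_list_RLR: "sum_list (RLR xs) = length xs"
  using length_run_decode[of "RLE xs"] by (simp add: RLR_def run_decode_RLE)

section \<open>Sums over disjoint blocks and rearrangement of segments\<close>

lemma sum_Union_list: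
  assumes "\<forall>i<length Xs. \<forall>j<length Xs. i \<noteq> j \<longrightarrow> Xs ! i \<inter> Xs ! j = {}"
    and "\<forall>X\<in>set Xs. finite X"
  shows "sum f (\<Union> (set Xs)) = sum_list (map (sum f) Xs)"
proof -
  \<comment> \<open>Indexing by positions matches both the disjointness hypothesis and the summation
    over the list.\<close>
  have "\<Union> (set Xs) = (\<Union>i\<in>{..<length Xs}. Xs ! i)"
    by (auto simp: set_conv_nth)
  also have "sum f \<dots> = (\<Sum>i<length Xs. sum f (Xs ! i))"
    using assms by (intro sum.UNION_disjoint) auto
  also have "\<dots> = sum_list (map (sum f) Xs)"
    by (simp add: sum_list_sum_nth atLeast0LessThan)
  finally show ?thesis .
qed

lemma sum_list_card_disjoint:
  assumes "\<forall>i<length Xs. \<forall>j<length Xs. i \<noteq> j \<longrightarrow> Xs ! i \<inter> Xs ! j = {}"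
    and "\<forall>X\<in>set Xs. finite X"
  shows "sum_list (map card Xs) = card (\<Union> (set Xs))"
proof -
  have "card = sum (\<lambda>_::'a. 1::nat)" by (simp add: fun_eq_iff)
  then show ?thesis using sum_Union_list[OF assms, of "\<lambda>_. 1"] by metis
qed

text \<open>Both words concatenate the same segments, in possibly different orders. This transfers
  being a permutation between \<tau> and \<pi>, in either direction.\<close>

lemma concat_seg_word_rearrange:
  assumes disj: "\<forall>i<length \<chi>. \<forall>j<length \<chi>. i \<noteq> j \<longrightarrow> \<chi> ! i \<inter> \<chi> ! j = {}"
    and seg: "segment_set (\<Union> (set \<chi>))"
  shows "set (concat (map seg_word \<chi>)) = set (seg_word (\<Union> (set \<chi>)))"
    and "length (concat (map seg_word \<chi>)) = length (seg_word (\<Union> (set \<chi>)))"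
proof -
  have segs: "segment_set X" if "X \<in> set \<chi>" for X
    using segment_set_subset[OF seg] that by blast
  then have fin: "\<forall>X\<in>set \<chi>. finite X" by (simp add: segment_set_def)
  show "set (concat (map seg_word \<chi>)) = set (seg_word (\<Union> (set \<chi>)))"
    using segs by (auto simp: set_seg_word[OF seg] set_seg_word)
  have "map length (map seg_word \<chi>) = map (sum length) \<chi>"
    using segs by (simp add: length_seg_word)
  then show "length (concat (map seg_word \<chi>)) = length (seg_word (\<Union> (set \<chi>)))"
    using sum_Union_list[OF disj fin, of length]
    by (simp only: length_concat length_seg_word[OF seg])
qed

text \<open>A list has no repeated letter exactly when its length is the size of its letter
  set.\<close>

lemma permutations_of_set_transfer:
  assumes "xs \<in> permutations_of_set A" "set ys = set xs" "length ys = length xs"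
  shows "ys \<in> permutations_of_set A"
proof -
  have "card (set ys) = length ys"
    using assms distinct_card[of xs] by (simp add: permutations_of_set_def)
  then show ?thesis using assms card_distinct[of ys] by (simp add: permutations_of_set_def)
qed

section \<open>The domain of \<open>h\<close> and the two compositions of \<open>h\<close> with
  \<open>h_inv\<close>\<close>

definition Mad_segments :: "nat \<Rightarrow> (nat list \<times> nat list set list) set" where
  "Mad_segments n = (\<Union>\<pi>\<in>permutations_of_set {1..n}. Mad (LMin \<pi>))"

text \<open>Eliminates the permutation \<pi>: the blocks have union \<open>LMin \<pi>\<close>, from
  which \<open>seg_word\<close> recovers \<pi>.\<close>

lemma Mad_segmentsD:
  assumes "(\<alpha>, \<chi>) \<in> Mad_segments n"
  shows "\<alpha> \<in> Asc (length \<alpha>)"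
    and "map card \<chi> = RLR \<alpha>"
    and "\<forall>i<length \<chi>. \<forall>j<length \<chi>. i \<noteq> j \<longrightarrow> \<chi> ! i \<inter> \<chi> ! j = {}"
    and "segment_set (\<Union> (set \<chi>))"
    and "seg_word (\<Union> (set \<chi>)) \<in> permutations_of_set {1..n}"
proof -
  obtain \<pi> where \<pi>: "\<pi> \<in> permutations_of_set {1..n}" "\<alpha> \<in> Asc (card (LMin \<pi>))"
    "\<chi> \<in> ordered_set_partitions (LMin \<pi>) (RLR \<alpha>)"
    using assms by (auto simp: Mad_segments_def Mad_def)
  then show "\<alpha> \<in> Asc (length \<alpha>)" by (auto simp: Asc_def)
  have U: "\<Union> (set \<chi>) = LMin \<pi>" using \<pi>(3) by (simp add: ordered_set_partitions_def)
  show "map card \<chi> = RLR \<alpha>"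
    and "\<forall>i<length \<chi>. \<forall>j<length \<chi>. i \<noteq> j \<longrightarrow> \<chi> ! i \<inter> \<chi> ! j = {}"
    using \<pi>(3) by (auto simp: ordered_set_partitions_def intro: nth_equalityI)
  show "segment_set (\<Union> (set \<chi>))" "seg_word (\<Union> (set \<chi>)) \<in> permutations_of_set {1..n}"
    using \<pi>(1) by (auto simp: U segment_set_LMin seg_word_LMin)
qed

lemma h_Mad_segments:
  assumes "(\<alpha>, \<chi>) \<in> Mad_segments n"
  shows "h (\<alpha>, \<chi>) \<in> Asc n \<times> permutations_of_set {1..n}"
    and "h_inv (h (\<alpha>, \<chi>)) = (\<alpha>, \<chi>)"
proof -
  note D = Mad_segmentsD[OF assms]
  let ?cs = "map fst (RLE \<alpha>)" and ?ls = "map (length \<circ> seg_word) \<chi>"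
    and ?\<tau> = "concat (map seg_word \<chi>)"
  have len: "length (RLE \<alpha>) = length \<chi>"
    using arg_cong[OF D(2), of length] by (simp add: RLR_def)
  have pos: "\<forall>X\<in>set \<chi>. 1 \<le> card X"
    using RLR_pos[of \<alpha>] by (simp add: D(2)[symmetric])
  have \<alpha>: "\<alpha> = run_decode (zip ?cs (map card \<chi>))"
    by (simp add: D(2) run_decode_zip_RLE)
  have h: "h (\<alpha>, \<chi>) = (run_decode (zip ?cs ?ls), ?\<tau>)"
    using h_run_decode[of ?cs \<chi>] len pos by (simp add: \<alpha>[symmetric])
  have segs: "segment_set X" if "X \<in> set \<chi>" for X
    using segment_set_subset[OF D(4)] that by blast
  have LMin: "map LMin (map seg_word \<chi>) = \<chi>"
    using segs by (simp add: LMin_seg_word map_idI)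
  \<comment> \<open>The new run lengths must be positive for the runs of the image to have the same
    values as those of \<alpha>.\<close>
  have "seg_word X \<noteq> []" if "X \<in> set \<chi>" for X
  proof
    assume "seg_word X = []"
    then have "X = {}" using LMin_seg_word[OF segs[OF that]] by (simp add: LMin_Nil)
    then show False using pos that by auto
  qed
  then have ls_pos: "\<forall>l\<in>set ?ls. 1 \<le> l" by (auto simp: Suc_le_eq)
  \<comment> \<open>Neighbouring run values still differ, so no runs merge and \<open>h_inv\<close>
    can read off the piece lengths.\<close>
  have RLE: "RLE (run_decode (zip ?cs ?ls)) = zip ?cs ?ls"
    using ls_pos len RLE_distinct_adj by (intro RLE_run_decode_zip) auto
  have \<tau>: "?\<tau> \<in> permutations_of_set {1..n}"
    using permutations_of_set_transfer[OF D(5)] concat_seg_word_rearrange[OF D(3,4)] by blast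
  then have "length ?\<tau> = n" by (simp add: permutations_of_set_def distinct_card[symmetric])
  moreover have "run_decode (zip ?cs ?ls) \<in> Asc (sum_list ?ls)"
    using change_run_lengths_in_Asc[OF D(1)] len ls_pos by simp
  ultimately show "h (\<alpha>, \<chi>) \<in> Asc n \<times> permutations_of_set {1..n}"
    using \<tau> by (simp add: h length_concat comp_def)
  have "chunks ?ls ?\<tau> = map seg_word \<chi>"
    using chunks_concat[of "map seg_word \<chi>"] by simp
  moreover have "RLR (run_decode (zip ?cs ?ls)) = ?ls"
    using len by (simp add: RLR_def RLE)
  ultimately show "h_inv (h (\<alpha>, \<chi>)) = (\<alpha>, \<chi>)"
    using len LMin \<alpha>[symmetric] by (simp add: h h_inv_def RLE Let_def del: map_map)
qed

lemma distinct_concat_nth_disjoint: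
  assumes "distinct (concat ws)" "i < length ws" "j < length ws" "i \<noteq> j"
  shows "set (ws ! i) \<inter> set (ws ! j) = {}"
  using assms
proof (induction ws arbitrary: i j)
  case (Cons w ws)
  have d: "distinct (concat ws)" and w: "set w \<inter> set (concat ws) = {}"
    using Cons.prems(1) by auto
  have disj: "set w \<inter> set (ws ! k) = {}" if "k < length ws" for k
    using w nth_mem[OF that] by (fastforce simp only: set_concat)
  show ?case
  proof (cases i)
    case 0
    then obtain j' where "j = Suc j'" using Cons.prems(4) by (cases j) auto
    then show ?thesis using disj[of j'] Cons.prems(3) 0 by simp
  next
    case (Suc i')
    show ?thesis
    proof (cases j)
      case 0
      then show ?thesis using disj[of i'] Cons.prems(2) Suc by (simp add: Int_commute)
    next
      case (Suc j')
      then show ?thesis using Cons.IH[OF d, of i' j'] Cons.prems \<open>i = Suc i'\<close> by simp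
    qed
  qed
qed simp

lemma h_inv_Asc_permutation:
  assumes \<beta>: "\<beta> \<in> Asc n" and \<tau>: "\<tau> \<in> permutations_of_set {1..n}"
  shows "h_inv (\<beta>, \<tau>) \<in> Mad_segments n"
    and "h (h_inv (\<beta>, \<tau>)) = (\<beta>, \<tau>)"
proof -
  have len\<beta>: "length \<beta> = n" using \<beta> by (simp add: Asc_def)
  have len\<tau>: "length \<tau> = n"
    using \<tau> by (simp add: permutations_of_set_def distinct_card[symmetric])
  define ws where "ws = chunks (RLR \<beta>) \<tau>"
  have ws: "concat ws = \<tau>" "map length ws = RLR \<beta>"
    using chunks_inverse[of "RLR \<beta>" \<tau>] by (simp_all add: ws_def sum_list_RLR len\<beta> len\<tau>)
  define \<chi> where "\<chi> = map LMin ws"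
  let ?cs = "map fst (RLE \<beta>)"
  define \<alpha> where "\<alpha> = run_decode (zip ?cs (map card \<chi>))"
  have g: "h_inv (\<beta>, \<tau>) = (\<alpha>, \<chi>)" by (simp add: h_inv_def \<alpha>_def \<chi>_def ws_def Let_def)
  have len: "length (RLE \<beta>) = length \<chi>"
    using arg_cong[OF ws(2), of length] by (simp add: RLR_def \<chi>_def)
  \<comment> \<open>Nonempty pieces give nonempty blocks, hence positive run lengths for
    \<alpha>.\<close>
  have ws_ne: "w \<noteq> []" if "w \<in> set ws" for w
    using RLR_pos[of \<beta>] that by (auto simp: ws(2)[symmetric])
  have fin: "\<forall>X\<in>set \<chi>. finite X"
    using segment_set_LMin by (auto simp: \<chi>_def segment_set_def)
  have pos: "\<forall>X\<in>set \<chi>. 1 \<le> card X"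
    using fin LMin_ne ws_ne by (auto simp: \<chi>_def Suc_le_eq card_gt_0_iff)
  have seg\<chi>: "map seg_word \<chi> = ws" by (simp add: \<chi>_def seg_word_LMin map_idI)
  show "h (h_inv (\<beta>, \<tau>)) = (\<beta>, \<tau>)"
  proof -
    have "map (length \<circ> seg_word) \<chi> = RLR \<beta>"
      using ws(2) seg\<chi> by (metis map_map)
    then show ?thesis
      using h_run_decode[of ?cs \<chi>] len pos seg\<chi> ws(1)
      by (simp add: g \<alpha>_def run_decode_zip_RLE)
  qed
  have hd_in: "is_segment b" "hd b \<in> set w" if "b \<in> LMin w" for b w
  proof -
    show "is_segment b" using segment_set_LMin that by (auto simp: segment_set_def)
    then show "hd b \<in> set w"
      using set_seg_word[OF segment_set_LMin, of w] that
      by (auto simp: seg_word_LMin is_segment_def intro!: bexI[of _ b])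
  qed
  have distinct: "distinct (concat ws)"
    using \<tau> ws(1) by (simp add: permutations_of_set_def)
  \<comment> \<open>Different pieces of a permutation share no letter, so a first letter identifies
    its piece. This yields both disjoint blocks and injectivity of \<open>hd\<close> on their
    union.\<close>
  have same: "i = j" if "i < length ws" "j < length ws" "b \<in> LMin (ws ! i)" "c \<in> LMin (ws ! j)"
    "hd b = hd c" for i j b c
    using distinct_concat_nth_disjoint[OF distinct that(1,2)] hd_in(2)[OF that(3)]
      hd_in(2)[OF that(4)] that(5) by auto
  have disj: "\<forall>i<length \<chi>. \<forall>j<length \<chi>. i \<noteq> j \<longrightarrow> \<chi> ! i \<inter> \<chi> ! j = {}"
    using same by (fastforce simp: \<chi>_def)
  have "inj_on hd (\<Union> (set \<chi>))"
  proof (rule inj_onI)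
    fix b c assume b: "b \<in> \<Union> (set \<chi>)" and c: "c \<in> \<Union> (set \<chi>)" and eq: "hd b = hd c"
    obtain i where i: "i < length ws" "b \<in> LMin (ws ! i)"
      using b by (auto simp: \<chi>_def in_set_conv_nth)
    obtain j where j: "j < length ws" "c \<in> LMin (ws ! j)"
      using c by (auto simp: \<chi>_def in_set_conv_nth)
    have "i = j" using same i j eq by blast
    then show "b = c"
      using segment_set_LMin[of "ws ! i"] i j eq by (auto simp: segment_set_def inj_on_def)
  qed
  then have seg: "segment_set (\<Union> (set \<chi>))"
    using fin hd_in(1) by (auto simp: segment_set_def \<chi>_def)
  \<comment> \<open>The witness for membership in the domain: all segments of all pieces, merged in
    decreasing order of first letters.\<close>
  define \<pi> where "\<pi> = seg_word (\<Union> (set \<chi>))"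
  have \<pi>: "\<pi> \<in> permutations_of_set {1..n}"
    using permutations_of_set_transfer[OF \<tau>] concat_seg_word_rearrange[OF disj seg]
    by (simp add: \<pi>_def seg\<chi> ws(1))
  have LMin: "LMin \<pi> = \<Union> (set \<chi>)" by (simp add: \<pi>_def LMin_seg_word[OF seg])
  \<comment> \<open>By disjointness of the blocks, this length is the number of segments of
    \<pi>.\<close>
  have "\<alpha> \<in> Asc (sum_list (map card \<chi>))"
    unfolding \<alpha>_def using \<beta> len\<beta> len pos by (intro change_run_lengths_in_Asc) auto
  then have "\<alpha> \<in> Asc (card (LMin \<pi>))"
    by (simp add: LMin sum_list_card_disjoint[OF disj fin])
  moreover have "RLR \<alpha> = map card \<chi>"
  proof -
    have "RLE \<alpha> = zip ?cs (map card \<chi>)"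
      unfolding \<alpha>_def using len pos RLE_distinct_adj by (intro RLE_run_decode_zip) auto
    then show ?thesis using len by (simp add: RLR_def)
  qed
  then have "\<chi> \<in> ordered_set_partitions (LMin \<pi>) (RLR \<alpha>)"
    using disj by (simp add: ordered_set_partitions_def LMin)
  ultimately show "h_inv (\<beta>, \<tau>) \<in> Mad_segments n"
    using \<pi> by (auto simp: g Mad_segments_def Mad_def)
qed

theorem theorem21:
  fixes n :: nat
  assumes "n \<ge> 1"
  shows "bij_betw h (\<Union>\<pi>\<in>permutations_of_set {1..n}. Mad (LMin \<pi>))
                    (Asc n \<times> permutations_of_set {1..n})"
  unfolding Mad_segments_def[symmetric]
proof (rule bij_betw_byWitness[where f' = h_inv])
  show "\<forall>a\<in>Mad_segments n. h_inv (h a) = a"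
    using h_Mad_segments(2) by auto
  show "\<forall>b\<in>Asc n \<times> permutations_of_set {1..n}. h (h_inv b) = b"
    using h_inv_Asc_permutation(2) by auto
  show "h ` Mad_segments n \<subseteq> Asc n \<times> permutations_of_set {1..n}"
    using h_Mad_segments(1) by (intro image_subsetI) (metis surj_pair)
  show "h_inv ` (Asc n \<times> permutations_of_set {1..n}) \<subseteq> Mad_segments n"
    using h_inv_Asc_permutation(1) by auto
qed

end
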